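(* Let $\mathbb{K}=\mathbb{R}$ or $\mathbb{C}$, and let $n\ge 2$, $r\ge 2$, $s\ge 1$ be integers. If a polynomial map $F$ belongs to the class $\mathcal{C}^n_{r,s}$ and satisfies the Jacobian condition, then $F$ is a counterexample to the Jacobian conjecture, i.e. $F$ satisfies the Jacobian condition but is not a polynomial automorphism of $\mathbb{K}^2$.
   Context: A polynomial map $F:\mathbb{K}^2\to\mathbb{K}^2$ is non-proper if there is a sequence $\{z_k\}\subset\mathbb{K}^2$ with $\|z_k\|\to+\infty$ such that $F(z_k)$ converges to a (finite) point of $\mathbb{K}^2$. For integers $n\ge 1$, $r,s\ge 1$, and $b\in\mathbb{K}\setminus\{0\}$, let $u_0(x,y)=y$ and $u_i(x,y)=x^i-b^i x^{ir}y^{is}$ for $i=1,\dots,n$. $\mathcal{C}^n_{r,s}$ denotes the set of non-proper polynomial maps $F:\mathbb{K}^2\to\mathbb{K}^2$ of the form $F=H(u_0,u_1,\dots,u_n)$, where $H=(H_1,H_2):\mathbb{K}^{n+1}\to\mathbb{K}^2$ is a polynomial map. The map $F$ satisfies the Jacobian condition if there is a constant $c\in\mathbb{K}\setminus\{0\}$ with $\det JF(x,y)=c$ for all $(x,y)\in\mathbb{K}^2$, where $JF(x,y)$ is the Jacobian matrix. The Jacobian conjecture asserts that any polynomial map $\mathbb{K}^2\to\mathbb{K}^2$ satisfying the Jacobian condition is a polynomial automorphism (a bijective polynomial map with polynomial inverse). *)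

theory Defs
  imports "HOL-Analysis.Analysis" "HOL-Library.Poly_Mapping"
begin

text \<open>
  Multivariate polynomials with variables indexed by \<open>'v\<close> and coefficients in \<open>'a\<close> are finitely
  supported functions from monomials (finitely supported exponent functions) to coefficients.
\<close>

type_synonym ('v, 'a) mpolynomial = "('v \<Rightarrow>\<^sub>0 nat) \<Rightarrow>\<^sub>0 'a"

definition eval_mpoly :: "('v \<Rightarrow> 'a::comm_semiring_1) \<Rightarrow> ('v, 'a) mpolynomial \<Rightarrow> 'a" where
  "eval_mpoly a p =
     (\<Sum>m\<in>Poly_Mapping.keys p. Poly_Mapping.lookup p m *
        (\<Prod>i\<in>Poly_Mapping.keys m. a i ^ Poly_Mapping.lookup m i))"

definition mpoly_vars :: "('v, 'a::zero) mpolynomial \<Rightarrow> 'v set" where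
  "mpoly_vars p = (\<Union>m\<in>Poly_Mapping.keys p. Poly_Mapping.keys m)"

definition polynomial_map :: "('a::comm_semiring_1 ^ 'n \<Rightarrow> 'a ^ 'm) \<Rightarrow> bool" where
  "polynomial_map F \<longleftrightarrow>
     (\<exists>P :: 'm \<Rightarrow> ('n, 'a) mpolynomial. \<forall>z k. F z $ k = eval_mpoly (\<lambda>j. z $ j) (P k))"

definition polynomial_automorphism :: "('a::comm_semiring_1 ^ 'n \<Rightarrow> 'a ^ 'n) \<Rightarrow> bool" where
  "polynomial_automorphism F \<longleftrightarrow> polynomial_map F \<and> bij F \<and> polynomial_map (inv F)"

definition non_proper :: "('a::real_normed_field ^ 2 \<Rightarrow> 'a ^ 2) \<Rightarrow> bool" where
  "non_proper F \<longleftrightarrow>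
     (\<exists>z :: nat \<Rightarrow> 'a ^ 2. filterlim (\<lambda>k. norm (z k)) at_top sequentially \<and>
        (\<exists>w. (\<lambda>k. F (z k)) \<longlonglongrightarrow> w))"

text \<open>
  Row \<open>i\<close>, column \<open>j\<close> holds the partial derivative of the \<open>i\<close>-th component with respect to the
  \<open>j\<close>-th variable; over the complex numbers this is the complex derivative.
\<close>

definition jacobian_matrix :: "('a::real_normed_field ^ 2 \<Rightarrow> 'a ^ 2) \<Rightarrow> 'a ^ 2 \<Rightarrow> 'a ^ 2 ^ 2" where
  "jacobian_matrix F z =
     (\<chi> i j. deriv (\<lambda>t. F (\<chi> l. if l = j then t else z $ l) $ i) (z $ j))"

definition jacobian_condition :: "('a::real_normed_field ^ 2 \<Rightarrow> 'a ^ 2) \<Rightarrow> bool" where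
  "jacobian_condition F \<longleftrightarrow> (\<exists>c. c \<noteq> 0 \<and> (\<forall>z. det (jacobian_matrix F z) = c))"

definition jacobian_counterexample :: "('a::real_normed_field ^ 2 \<Rightarrow> 'a ^ 2) \<Rightarrow> bool" where
  "jacobian_counterexample F \<longleftrightarrow>
     polynomial_map F \<and> jacobian_condition F \<and> \<not> polynomial_automorphism F"

text \<open>A point \<open>z\<close> of the plane has coordinates \<open>x = z $ 1\<close> and \<open>y = z $ 2\<close>.\<close>

definition u :: "'a::real_normed_field \<Rightarrow> nat \<Rightarrow> nat \<Rightarrow> nat \<Rightarrow> 'a ^ 2 \<Rightarrow> 'a" where
  "u b r s i z =
     (if i = 0 then z $ 2
      else (z $ 1) ^ i - b ^ i * (z $ 1) ^ (i * r) * (z $ 2) ^ (i * s))"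

text \<open>
  The polynomial map \<open>H\<close> on the \<open>(n + 1)\<close>-dimensional space is given by two polynomials in the
  variables with indices \<open>0, \<dots>, n\<close>.
\<close>

definition class_C :: "'a::real_normed_field \<Rightarrow> nat \<Rightarrow> nat \<Rightarrow> nat \<Rightarrow> ('a ^ 2 \<Rightarrow> 'a ^ 2) set" where
  "class_C b n r s =
     {F. polynomial_map F \<and> non_proper F \<and>
         (\<exists>H :: 2 \<Rightarrow> (nat, 'a) mpolynomial.
            (\<forall>k. mpoly_vars (H k) \<subseteq> {0..n}) \<and>
            (\<forall>z k. F z $ k = eval_mpoly (\<lambda>i. u b r s i z) (H k)))}"

end

theory Submission
  imports Defs
begin

text \<open>
  A polynomial automorphism is a homeomorphism, and hence proper: if \<open>F (z k)\<close> converges to \<open>w\<close>,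
  then applying the inverse of \<open>F\<close>, which is a polynomial map and so continuous, shows that \<open>z k\<close>
  converges to the preimage of \<open>w\<close>. In particular \<open>z k\<close> is bounded. A non-proper map is therefore
  never an automorphism, and non-properness is part of what membership in \<open>class_C b n r s\<close> asserts.
  The argument is the same over every real normed field, which covers the real and the complex case.
\<close>

lemma continuous_on_polynomial_map:
  fixes F :: "'a::real_normed_field ^ 'n \<Rightarrow> 'a ^ 'm"
  assumes "polynomial_map F"
  shows "continuous_on UNIV F"
proof -
  obtain P :: "'m \<Rightarrow> ('n, 'a) mpolynomial"
    where P: "\<And>z k. F z $ k = eval_mpoly (\<lambda>j. z $ j) (P k)"
    using assms unfolding polynomial_map_def by blast
  have F: "F = (\<lambda>z. \<chi> k. eval_mpoly (\<lambda>j. z $ j) (P k))"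
    by (simp add: fun_eq_iff vec_eq_iff P)
  show ?thesis
    unfolding F eval_mpoly_def by (intro continuous_intros)
qed

lemma polynomial_automorphism_imp_not_non_proper:
  fixes F :: "'a::real_normed_field ^ 2 \<Rightarrow> 'a ^ 2"
  assumes "polynomial_automorphism F"
  shows "\<not> non_proper F"
proof
  assume "non_proper F"
  then obtain z w where z: "filterlim (\<lambda>k. norm (z k)) at_top sequentially"
    and w: "(\<lambda>k. F (z k)) \<longlonglongrightarrow> w"
    unfolding non_proper_def by blast
  have "inj F" and "continuous_on UNIV (inv F)"
    using assms by (auto simp: polynomial_automorphism_def bij_is_inj continuous_on_polynomial_map)
  then have "(\<lambda>k. inv F (F (z k))) \<longlonglongrightarrow> inv F w"
    by (intro continuous_on_tendsto_compose[where s = UNIV, OF _ w]) simp_all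
  then have "(\<lambda>k. norm (z k)) \<longlonglongrightarrow> norm (inv F w)"
    using \<open>inj F\<close> by (simp add: tendsto_norm)
  with z show False
    using not_tendsto_and_filterlim_at_infinity[OF sequentially_bot]
      filterlim_at_top_imp_at_infinity by blast
qed

lemma class_C_imp_jacobian_counterexample:
  assumes "F \<in> class_C b n r s" and "jacobian_condition F"
  shows "jacobian_counterexample F"
  using assms polynomial_automorphism_imp_not_non_proper
  unfolding class_C_def jacobian_counterexample_def by blast

theorem corollary2p25:
  fixes n r s :: nat
  assumes "n \<ge> 2" and "r \<ge> 2" and "s \<ge> 1"
  shows "(\<forall>(b :: real) (F :: real ^ 2 \<Rightarrow> real ^ 2).
            b \<noteq> 0 \<longrightarrow> F \<in> class_C b n r s \<longrightarrow> jacobian_condition F \<longrightarrow>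
            jacobian_counterexample F) \<and>
         (\<forall>(b :: complex) (F :: complex ^ 2 \<Rightarrow> complex ^ 2).
            b \<noteq> 0 \<longrightarrow> F \<in> class_C b n r s \<longrightarrow> jacobian_condition F \<longrightarrow>
            jacobian_counterexample F)"
  by (simp add: class_C_imp_jacobian_counterexample)

end
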